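(* Let $D$ be a multipartite tournament with the sink elimination index $\zeta(D)\ge 1$ and the sink sequence $(W_0,\ldots,W_{\zeta(D)})$. For a vertex $u$, suppose that there exists a $(u,w)$-directed walk $Z$ of Type 2 of length $\ell$ for some vertex $w$ such that (i) $w$ belongs to $\bigcup_{i=0}^{\zeta(D)-1}W_i$, or (ii) there exists a directed hole of length $4$ such that its four vertices are on $Z$ and $w$ does not belong to any of the two partite sets which the four vertices belong to. Then there exists a positive integer $N$ such that for each integer $m\ge N$, there is a $(u,w)$-directed walk of length $\ell+2m$.
   Context: All digraphs are finite, and the underlying graph of each digraph is simple (no loops, no multiple arcs, no directed cycles of length $2$). A multipartite tournament is an orientation of a complete $k$-partite graph (with $k$ nonempty partite sets) for some integer $k\ge 2$. A $(u,w)$-directed walk is a directed walk from $u$ to $w$. A directed hole in $D$ is a directed cycle of length at least $4$ in $D$ that is an induced subdigraph of $D$. (A directed hole of length $4$ in a multipartite tournament has the form $v_0\to v_1\to v_2\to v_3\to v_0$ with $\{v_0,v_2\}\subseteq X$ and $\{v_1,v_3\}\subseteq Y$ for two distinct partite sets $X$, $Y$.) A directed walk in $D$ is of Type 2 if it contains four vertices which induce a directed hole of length $4$ in $D$. Sink sequence: a sink is a vertex of outdegree zero. Let $D_0=D$, and for each $i$ let $W_i$ be the set of sinks of $D_i$; if $W_i=V(D_i)$ or $W_i=\emptyset$, stop and put $\zeta(D)=i$; otherwise let $D_{i+1}=D_i-W_i$ (delete the vertices in $W_i$) and continue. The number $\zeta(D)$ is the sink elimination index of $D$, and $(W_0,\ldots,W_{\zeta(D)})$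 is the sink sequence of $D$. *)

theory Defs
  imports "Graph_Theory.Graph_Theory" "HOL-Library.Disjoint_Sets"
begin

text \<open>The locale \<open>digraph\<close> already gives finiteness and excludes loops and parallel arcs.\<close>

locale oriented_digraph = digraph +
  assumes no_2cycle: "u \<rightarrow>\<^bsub>G\<^esub> v \<Longrightarrow> \<not> v \<rightarrow>\<^bsub>G\<^esub> u"

text \<open>The family \<open>P\<close> of partite sets is determined by the digraph: its members are the classes
  of the non-adjacency relation.\<close>

locale multipartite_tournament = oriented_digraph D for D :: "('a, 'b) pre_digraph" +
  fixes P :: "'a set set"
  assumes partite_sets: "partition_on (verts D) P"
    and two_le_card: "2 \<le> card P"
    and adjacent_iff: "\<lbrakk>X \<in> P; Y \<in> P; x \<in> X; y \<in> Y\<rbrakk> \<Longrightarrow> (x \<rightarrow>\<^bsub>D\<^esub> y \<or> y \<rightarrow>\<^bsub>D\<^esub> x) \<longleftrightarrow> X \<noteq> Y"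

text \<open>A cycle is given by its list of arcs; its vertices are the tails of these arcs.\<close>

definition cycle_verts :: "('a, 'b) pre_digraph \<Rightarrow> 'b awalk \<Rightarrow> 'a set" where
  "cycle_verts D c = tail D ` set c"

definition cycle_digraph :: "('a, 'b) pre_digraph \<Rightarrow> 'b awalk \<Rightarrow> ('a, 'b) pre_digraph" where
  "cycle_digraph D c = \<lparr>verts = cycle_verts D c, arcs = set c, tail = tail D, head = head D\<rparr>"

definition directed_hole :: "('a, 'b) pre_digraph \<Rightarrow> 'b awalk \<Rightarrow> bool" where
  "directed_hole D c \<longleftrightarrow>
     pre_digraph.cycle D c \<and> 4 \<le> length c \<and> induced_subgraph (cycle_digraph D c) D"

definition type2_walk :: "('a, 'b) pre_digraph \<Rightarrow> 'a \<Rightarrow> 'b awalk \<Rightarrow> 'a \<Rightarrow> bool" where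
  "type2_walk D u Z w \<longleftrightarrow> pre_digraph.awalk D u Z w \<and>
     (\<exists>c. directed_hole D c \<and> length c = 4 \<and>
        cycle_verts D c \<subseteq> set (pre_digraph.awalk_verts D u Z))"

definition sinks :: "('a, 'b) pre_digraph \<Rightarrow> 'a set" where
  "sinks D = {v \<in> verts D. out_degree D v = 0}"

text \<open>The recursion runs on past the stopping index; this is harmless, as the index is the first
  one at which the stopping condition holds and the later digraphs are not used.\<close>

fun sink_elim :: "('a, 'b) pre_digraph \<Rightarrow> nat \<Rightarrow> ('a, 'b) pre_digraph" where
  "sink_elim D 0 = D"
| "sink_elim D (Suc i) = sink_elim D i \<restriction> (verts (sink_elim D i) - sinks (sink_elim D i))"

definition sink_sequence :: "('a, 'b) pre_digraph \<Rightarrow> nat \<Rightarrow> 'a set" where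
  "sink_sequence D i = sinks (sink_elim D i)"

definition sink_elim_stops :: "('a, 'b) pre_digraph \<Rightarrow> nat \<Rightarrow> bool" where
  "sink_elim_stops D i \<longleftrightarrow>
     sink_sequence D i = verts (sink_elim D i) \<or> sink_sequence D i = {}"

definition sink_elim_index :: "('a, 'b) pre_digraph \<Rightarrow> nat" where
  "sink_elim_index D = (LEAST i. sink_elim_stops D i)"

text \<open>The \<open>LEAST\<close> above is attained.\<close>

lemma (in fin_digraph) sink_elim_stops_sink_elim_index: "sink_elim_stops G (sink_elim_index G)"
proof -
  have "\<exists>i. sink_elim_stops G i"
  proof (rule ccontr)
    assume "\<nexists>i. sink_elim_stops G i"
    then have ne: "sinks (sink_elim G i) \<noteq> {}" for i
      by (auto simp: sink_elim_stops_def sink_sequence_def)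
    have fin: "finite (verts (sink_elim G i))" for i
      by (induction i) auto
    have psub: "verts (sink_elim G (Suc i)) \<subset> verts (sink_elim G i)" for i
      using ne[of i] by (auto simp: sinks_def)
    have "card (verts (sink_elim G i)) + i \<le> card (verts G)" for i
    proof (induction i)
      case (Suc i)
      then show ?case
        using psubset_card_mono[OF fin psub, of i] by linarith
    qed simp
    from this[of "Suc (card (verts G))"] show False by simp
  qed
  then show ?thesis unfolding sink_elim_index_def by (rule LeastI_ex)
qed

end

theory Submission
  imports Defs
begin

text \<open>
  Fix a directed hole \<open>v 0, v 1, v 2, v 3\<close> met by the walk, with indices read modulo 4, and
  prolong a walk from \<open>v 0\<close> arc by arc. As long as its endpoint \<open>x\<close>, reached in \<open>t\<close> steps, cannot
  also be reached in a number of steps congruent to \<open>t + 2\<close> modulo 4, the vertex \<open>x\<close> behaves like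
  \<open>v t\<close>: it lies in the partite set of \<open>v t\<close> and has a walk back to \<open>v 0\<close> whose length is congruent
  to \<open>-t\<close>. Neither is possible for the given endpoint \<open>w\<close>: a vertex removed by the sink
  elimination cannot reach a cycle, and in case (ii) \<open>w\<close> lies outside the two partite sets of the
  hole. So \<open>w\<close> is reached from \<open>v 0\<close> in both residues of the same parity, and winding around the
  hole realises all large lengths.
\<close>

section \<open>Walks of prescribed length\<close>

definition walk_len :: "('a, 'b) pre_digraph \<Rightarrow> nat \<Rightarrow> 'a \<Rightarrow> 'a \<Rightarrow> bool" where
  "walk_len D n x y \<longleftrightarrow> (\<exists>p. pre_digraph.awalk D x p y \<and> length p = n)"

context wf_digraph
begin

lemma walk_len_0: "x \<in> verts G \<Longrightarrow> walk_len G 0 x x"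
  unfolding walk_len_def by (auto simp: awalk_Nil_iff)

lemma walk_len_1:
  assumes "x \<rightarrow>\<^bsub>G\<^esub> y" shows "walk_len G 1 x y"
proof -
  from assms obtain e where "e \<in> arcs G" "tail G e = x" "head G e = y" by auto
  then have "awalk x [e] y" by (auto simp: arc_implies_awalk)
  then show ?thesis unfolding walk_len_def by (metis One_nat_def length_Cons list.size(3))
qed

lemma walk_len_trans: "walk_len G m x y \<Longrightarrow> walk_len G n y z \<Longrightarrow> walk_len G (m + n) x z"
  unfolding walk_len_def by (metis awalk_appendI length_append)

lemma walk_len_reachable: "walk_len G n x y \<Longrightarrow> x \<rightarrow>\<^sup>* y"
  unfolding walk_len_def using reachable_awalk by blast

end

text \<open>A hole of length 4 as a periodic sequence over all naturals, so that indices can be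
  added freely. The last conjunct, taken at \<open>i\<close> and at \<open>i + 2\<close>, excludes
  both orientations of a diagonal.\<close>

definition hole_cycle :: "('a, 'b) pre_digraph \<Rightarrow> (nat \<Rightarrow> 'a) \<Rightarrow> bool" where
  "hole_cycle D v \<longleftrightarrow> (\<forall>i. v i \<rightarrow>\<^bsub>D\<^esub> v (Suc i) \<and> v (i + 4) = v i \<and>
     \<not> v i \<rightarrow>\<^bsub>D\<^esub> v (i + 2))"

lemma (in wf_digraph) directed_hole_imp_hole_cycle:
  assumes "directed_hole G c" "length c = 4"
  obtains v where "hole_cycle G v" "range v = cycle_verts G c"
proof -
  have cyc: "cycle c" and ind: "induced_subgraph (cycle_digraph G c) G"
    using assms by (auto simp: directed_hole_def)
  obtain e0 e1 e2 e3 where c: "c = [e0, e1, e2, e3]"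
    using assms(2) by (auto simp: numeral_eq_Suc length_Suc_conv)
  from cyc have arcs: "{e0, e1, e2, e3} \<subseteq> arcs G"
    and heads: "head G e0 = tail G e1" "head G e1 = tail G e2" "head G e2 = tail G e3"
      "head G e3 = tail G e0"
    and dist: "distinct [tail G e0, tail G e1, tail G e2, tail G e3]"
    by (auto simp: c cycle_def awalk_Cons_iff awalk_Nil_iff)
  define v where "v i = tail G (c ! (i mod 4))" for i
  have mod4: "i mod 4 = 0 \<or> i mod 4 = 1 \<or> i mod 4 = 2 \<or> i mod 4 = 3" for i :: nat by linarith
  have mod_Suc: "Suc i mod 4 = (if i mod 4 = 3 then 0 else Suc (i mod 4))" for i :: nat by presburger
  have mod_2: "(i + 2) mod 4 = (if i mod 4 = 0 then 2 else if i mod 4 = 1 then 3 else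
    if i mod 4 = 2 then 0 else (1::nat))" for i :: nat by presburger
  have "range v = cycle_verts G c"
  proof -
    have "v 0 = tail G e0" "v 1 = tail G e1" "v 2 = tail G e2" "v 3 = tail G e3"
      by (simp_all add: v_def c)
    moreover have "v i \<in> {v 0, v 1, v 2, v 3}" for i
      using mod4[of i] by (auto simp: v_def c)
    ultimately show ?thesis by (auto simp: cycle_verts_def c image_iff) metis+
  qed
  moreover have "hole_cycle G v"
    unfolding hole_cycle_def
  proof (intro allI conjI)
    fix i
    have "c ! (i mod 4) \<in> arcs G" "head G (c ! (i mod 4)) = v (Suc i)"
      using mod4[of i] arcs heads by (auto simp: v_def c mod_Suc)
    then show "v i \<rightarrow>\<^bsub>G\<^esub> v (Suc i)"
      using in_arcs_imp_in_arcs_ends unfolding v_def by metis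
    show "v (i + 4) = v i" by (simp add: v_def)
    show "\<not> v i \<rightarrow>\<^bsub>G\<^esub> v (i + 2)"
    proof
      assume "v i \<rightarrow>\<^bsub>G\<^esub> v (i + 2)"
      then obtain a where a: "a \<in> arcs G" "tail G a = v i" "head G a = v (i + 2)" by auto
      have mem: "v j \<in> cycle_verts G c" for j
        using \<open>range v = cycle_verts G c\<close> by blast
      \<comment> \<open>Since the hole is induced, a chord would be one of its four arcs; but the
        only one with tail \<open>v i\<close> ends in \<open>v (Suc i)\<close>, which differs from
        \<open>v (i + 2)\<close>.\<close>
      have "a \<in> arcs (cycle_digraph G c)"
        using ind a mem[of i] mem[of "i + 2"]
        by (auto simp: induced_subgraph_def cycle_digraph_def arcs_ends_def arc_to_ends_def)
      then have "a \<in> set c" by (simp add: cycle_digraph_def)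
      then show False
        using mod4[of i] a dist heads mod_2[of i] by (auto simp: v_def c simp del: add_2_eq_Suc')
    qed
  qed
  ultimately show ?thesis using that by blast
qed

section \<open>Walks starting on a hole of length 4\<close>

context multipartite_tournament
begin

lemma hole_cycle_walk:
  assumes "hole_cycle D v"
  shows "walk_len D n (v i) (v (i + n))"
proof (induction n)
  case 0
  have "v i \<rightarrow>\<^bsub>D\<^esub> v (Suc i)" using assms by (simp add: hole_cycle_def)
  then show ?case using walk_len_0 adj_in_verts(1) by simp
next
  case (Suc n)
  have "v (i + n) \<rightarrow>\<^bsub>D\<^esub> v (Suc (i + n))" using assms by (simp add: hole_cycle_def)
  from walk_len_trans[OF Suc walk_len_1[OF this]] show ?case by simp
qed

lemma hole_cycle_period:
  assumes "hole_cycle D v" shows "v (i + 4 * k) = v i"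
proof (induction k)
  case (Suc k)
  have "v (i + 4 * Suc k) = v ((i + 4 * k) + 4)" by (simp add: algebra_simps)
  also have "\<dots> = v i" using assms Suc by (metis hole_cycle_def)
  finally show ?case .
qed simp

lemma hole_cycle_walk_mod:
  assumes "hole_cycle D v" "4 dvd i + n"
  shows "walk_len D n (v i) (v 0)"
proof -
  obtain k where "i + n = 0 + 4 * k" using assms(2) by (auto elim: dvdE)
  then show ?thesis
    using hole_cycle_walk[OF assms(1), of n i] hole_cycle_period[OF assms(1), of 0 k] by simp
qed

lemma partE:
  assumes "x \<in> verts D" obtains X where "X \<in> P" "x \<in> X"
  using assms partite_sets by (auto simp: partition_on_def)

lemma hole_cycle_part:
  assumes "hole_cycle D v" "X \<in> P" "v i \<in> X"
  shows "v (i + 2) \<in> X"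
proof -
  have arc: "v j \<rightarrow>\<^bsub>D\<^esub> v (Suc j)" for j using assms(1) by (simp add: hole_cycle_def)
  obtain Y where Y: "Y \<in> P" "v (i + 2) \<in> Y" using partE adj_in_verts(1)[OF arc] by metis
  have "\<not> v i \<rightarrow>\<^bsub>D\<^esub> v (i + 2)" using assms(1) by (simp add: hole_cycle_def)
  \<comment> \<open>By periodicity the reverse arc would run from \<open>v (i + 2)\<close> to
    \<open>v (i + 4)\<close>, again a forbidden diagonal.\<close>
  moreover have "\<not> v (i + 2) \<rightarrow>\<^bsub>D\<^esub> v i"
  proof -
    have "\<not> v (i + 2) \<rightarrow>\<^bsub>D\<^esub> v ((i + 2) + 2)" "v (i + 4) = v i"
      using assms(1) unfolding hole_cycle_def by blast+
    moreover have "(i + 2) + 2 = i + 4" by simp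
    ultimately show ?thesis by metis
  qed
  ultimately have "X = Y"
    using adjacent_iff[OF assms(2) Y(1) assms(3) Y(2)] by simp
  then show ?thesis using Y by simp
qed

text \<open>Induction on appended arcs. The first alternative survives an extra arc, as both lengths
  grow by one. Under the second, the arcs between the new endpoint and the hole are forced: any
  other orientation produces the first alternative.\<close>

lemma hole_cycle_walk_cases:
  assumes hole: "hole_cycle D v" and "awalk (v 0) p x"
  shows "(\<exists>n. walk_len D n (v 0) x \<and> n mod 4 = (length p + 2) mod 4) \<or>
    ((\<exists>k. walk_len D k x (v 0) \<and> 4 dvd length p + k) \<and> (\<exists>X\<in>P. x \<in> X \<and> v (length p) \<in> X))"
  using assms(2)
proof (induction p arbitrary: x rule: rev_induct)
  case Nil
  then have "x = v 0" "v 0 \<in> verts D" by (auto simp: awalk_Nil_iff)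
  then obtain X where "X \<in> P" "x \<in> X" "v 0 \<in> X" using partE by metis
  moreover have "walk_len D 0 x (v 0)" using \<open>x = v 0\<close> \<open>v 0 \<in> verts D\<close> walk_len_0 by simp
  ultimately show ?case by (intro disjI2 conjI exI[of _ 0] bexI[of _ X]) simp_all
next
  case (snoc e p y)
  define t where "t = length p"
  define x where "x = tail D e"
  have walk: "awalk (v 0) p x" and xy: "x \<rightarrow>\<^bsub>D\<^esub> y"
    using snoc.prems by (auto simp: x_def awalk_Cons_iff awalk_Nil_iff in_arcs_imp_in_arcs_ends)
  have tx: "walk_len D t (v 0) x" using walk by (auto simp: walk_len_def t_def)
  have ty: "walk_len D (t + 1) (v 0) y" using walk_len_trans[OF tx walk_len_1[OF xy]] .
  let ?goal = "\<exists>n. walk_len D n (v 0) y \<and> n mod 4 = (t + 3) mod 4"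
  \<comment> \<open>A closed walk at \<open>v 0\<close> whose length is not divisible by 4 suffices:
    it or its double has length 2 modulo 4 and can be put in front of the walk to
    \<open>y\<close>.\<close>
  have goal_odd: ?goal if "walk_len D n (v 0) (v 0)" "n mod 4 \<noteq> 0" for n
  proof -
    have "walk_len D (n + n) (v 0) (v 0)" using walk_len_trans that(1) by blast
    then have "walk_len D (n + (t + 1)) (v 0) y" "walk_len D (n + n + (t + 1)) (v 0) y"
      using walk_len_trans that(1) ty by blast+
    moreover have "(k + (t + 1)) mod 4 = (t + 3) mod 4" if "k mod 4 = 2" for k
    proof -
      have "(k + (t + 1)) mod 4 = (2 + (t + 1)) mod 4"
        using that by (intro mod_add_cong) simp_all
      also have "2 + (t + 1) = t + 3" by simp
      finally show ?thesis .
    qed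
    moreover have "n mod 4 = 2 \<or> (n + n) mod 4 = 2" using that(2) by presburger
    ultimately show ?thesis by blast
  qed
  have len: "length (p @ [e]) + 2 = t + 3" "length (p @ [e]) = t + 1" by (simp_all add: t_def)
  from snoc.IH[OF walk] show ?case
  proof (elim disjE conjE exE bexE)
    fix n assume "walk_len D n (v 0) x" "n mod 4 = (length p + 2) mod 4"
    then have "walk_len D (n + 1) (v 0) y" "(n + 1) mod 4 = ((t + 2) + 1) mod 4"
      using walk_len_trans walk_len_1[OF xy] mod_add_cong[of n 4 "t + 2" 1 1]
      unfolding t_def by blast+
    moreover have "(t + 2) + 1 = t + 3" by simp
    ultimately show ?thesis unfolding len(1) by metis
  next
    fix k X
    assume "walk_len D k x (v 0)" "4 dvd length p + k" and X: "X \<in> P" "x \<in> X" "v (length p) \<in> X"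
    have arc: "v j \<rightarrow>\<^bsub>D\<^esub> v (Suc j)" for j using hole by (simp add: hole_cycle_def)
    have "y \<in> verts D" using xy adj_in_verts by blast
    then obtain Y where Y: "Y \<in> P" "y \<in> Y" using partE by blast
    have XY: "X \<noteq> Y" using adjacent_iff[OF X(1) Y(1) X(2) Y(2)] xy by blast
    have from_hole: "walk_len D (j + 1) (v 0) y" if "v j \<rightarrow>\<^bsub>D\<^esub> y" for j
      using walk_len_trans[OF hole_cycle_walk[OF hole, of j 0, simplified] walk_len_1[OF that]] .
    have to_hole: "walk_len D (1 + j) y (v 0)" if "y \<rightarrow>\<^bsub>D\<^esub> v i" "4 dvd i + j" for i j
      using walk_len_trans[OF walk_len_1[OF that(1)] hole_cycle_walk_mod[OF hole that(2)]] .
    show ?thesis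
    proof (cases "?goal")
      case True
      then show ?thesis unfolding len(1) by blast
    next
      case False
      have "v (t + 2) \<in> X" using hole_cycle_part[OF hole X(1)] X(3) by (simp add: t_def)
      then have "v (t + 2) \<rightarrow>\<^bsub>D\<^esub> y \<or> y \<rightarrow>\<^bsub>D\<^esub> v (t + 2)"
        using adjacent_iff[OF X(1) Y(1) _ Y(2)] XY by blast
      \<comment> \<open>The opposite arc would give a walk from \<open>v 0\<close> to
        \<open>y\<close> of length \<open>t + 3\<close>.\<close>
      then have y_arc: "y \<rightarrow>\<^bsub>D\<^esub> v (t + 2)"
        using from_hole[of "t + 2"] False by (metis add.assoc numeral_plus_one semiring_norm(5))
      \<comment> \<open>From \<open>v (t + 2)\<close>, another \<open>3 * t + 2\<close> steps along
        the hole end at index \<open>4 * (t + 1)\<close>, that is, at \<open>v 0\<close>.\<close>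
      have ret: "walk_len D (1 + (3 * t + 2)) y (v 0)"
        by (rule to_hole[OF y_arc]) presburger
      have "v (t + 1) \<in> Y"
      proof (rule ccontr)
        assume notin: "v (t + 1) \<notin> Y"
        have "v (t + 1) \<in> verts D" using adj_in_verts(1)[OF arc] by blast
        then obtain Y' where Y': "Y' \<in> P" "v (t + 1) \<in> Y'" using partE by blast
        then have "v (t + 1) \<rightarrow>\<^bsub>D\<^esub> y \<or> y \<rightarrow>\<^bsub>D\<^esub> v (t + 1)"
          using adjacent_iff[OF Y'(1) Y(1) Y'(2) Y(2)] notin by blast
        \<comment> \<open>Either orientation closes a walk at \<open>v 0\<close> of length
          \<open>4 * t + 5\<close>, which is 1 modulo 4.\<close>
        then show False
        proof
          assume "v (t + 1) \<rightarrow>\<^bsub>D\<^esub> y"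
          moreover have "(t + 1 + 1 + (1 + (3 * t + 2))) mod 4 \<noteq> 0" by presburger
          ultimately show False
            using goal_odd walk_len_trans[OF from_hole ret] False by blast
        next
          assume "y \<rightarrow>\<^bsub>D\<^esub> v (t + 1)"
          then have "walk_len D (1 + (3 * t + 3)) y (v 0)"
            by (rule to_hole) presburger
          moreover have "(t + 1 + (1 + (3 * t + 3))) mod 4 \<noteq> 0" by presburger
          ultimately show False using goal_odd walk_len_trans[OF ty] False by blast
        qed
      qed
      moreover have "4 dvd (t + 1) + (1 + (3 * t + 2))" by presburger
      ultimately show ?thesis unfolding len(2) using ret Y by blast
    qed
  qed
qed

end

section \<open>Sink elimination and cycles\<close>

lemma tail_sink_elim [simp]: "tail (sink_elim D i) = tail D"
  and head_sink_elim [simp]: "head (sink_elim D i) = head D"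
  by (induction i) auto

text \<open>Only sinks are deleted, and no vertex of \<open>S\<close> is a sink while
  \<open>S\<close> and the arcs inside it are intact; hence \<open>S\<close> survives every
  round.\<close>

lemma (in fin_digraph) not_sink_if_closed:
  assumes S: "S \<subseteq> verts G" "\<And>x. x \<in> S \<Longrightarrow> \<exists>y\<in>S. x \<rightarrow>\<^bsub>G\<^esub> y"
  shows "S \<inter> sink_sequence G i = {}"
proof -
  \<comment> \<open>Finiteness is carried along because \<open>out_degree\<close> is a cardinality
    and would be 0 for infinitely many out-arcs.\<close>
  have inv: "finite (arcs (sink_elim G i)) \<and> S \<subseteq> verts (sink_elim G i) \<and>
      (\<forall>a\<in>arcs G. tail G a \<in> S \<and> head G a \<in> S \<longrightarrow> a \<in> arcs (sink_elim G i)) \<and>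
      S \<inter> sinks (sink_elim G i) = {}" for i
  proof -
    have no_sink: "S \<inter> sinks H = {}"
      if H: "finite (arcs H)" "tail H = tail G"
        "\<forall>a\<in>arcs G. tail G a \<in> S \<and> head G a \<in> S \<longrightarrow> a \<in> arcs H" for H :: "('a, 'b) pre_digraph"
    proof -
      have "out_degree H x \<noteq> 0" if x: "x \<in> S" for x
      proof -
        obtain y where "y \<in> S" "x \<rightarrow>\<^bsub>G\<^esub> y" using S(2)[OF x] by blast
        then obtain a where "a \<in> arcs G" "tail G a = x" "head G a = y" by auto
        then have "a \<in> out_arcs H x" using \<open>y \<in> S\<close> x H(2,3) by simp
        moreover have "finite (out_arcs H x)" using \<open>finite (arcs H)\<close> by (simp add: out_arcs_def)
        ultimately show ?thesis by (auto simp: out_degree_def)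
      qed
      then show ?thesis unfolding sinks_def by blast
    qed
    show ?thesis
    proof (induction i)
      case 0
      then show ?case using S(1) no_sink[of G] by simp
    next
      case (Suc i)
      let ?H = "sink_elim G (Suc i)"
      have "finite (arcs ?H)" "S \<subseteq> verts ?H"
        "\<forall>a\<in>arcs G. tail G a \<in> S \<and> head G a \<in> S \<longrightarrow> a \<in> arcs ?H"
        using Suc by (auto simp: induce_subgraph_def)
      then show ?case using no_sink[of ?H] by simp
    qed
  qed
  show ?thesis using inv[of i] by (simp add: sink_sequence_def)
qed

text \<open>The vertices with a nonempty walk to \<open>x\<close> form a closed set in the sense of
  \<open>not_sink_if_closed\<close>: the next vertex on such a walk is again one of them, even if it
  is \<open>x\<close>, because \<open>x\<close> lies on a closed walk.\<close>

lemma (in fin_digraph) sink_sequence_not_reachable: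
  assumes "w \<in> sink_sequence G i" "x \<rightarrow>\<^sup>+ x"
  shows "\<not> w \<rightarrow>\<^sup>* x"
proof
  assume "w \<rightarrow>\<^sup>* x"
  let ?S = "{y. y \<rightarrow>\<^sup>+ x}"
  have "w \<in> ?S" using \<open>w \<rightarrow>\<^sup>* x\<close> assms(2) by (simp add: reachable_reachable1_trans)
  moreover have "?S \<inter> sink_sequence G i = {}"
  proof (rule not_sink_if_closed)
    show "?S \<subseteq> verts G" by (auto dest: reachable1_in_verts)
    show "\<exists>z\<in>?S. y \<rightarrow>\<^bsub>G\<^esub> z" if "y \<in> ?S" for y
      using that assms(2) by (auto elim: converse_tranclE)
  qed
  ultimately show False using assms(1) by blast
qed

theorem lemma3p5:
  fixes D :: "('a, 'b) pre_digraph" and P :: "'a set set"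
    and u w :: 'a and Z :: "'b awalk" and l :: nat
  assumes "multipartite_tournament D P"
    and "1 \<le> sink_elim_index D"
    and "type2_walk D u Z w"
    and "length Z = l"
    and "w \<in> (\<Union>i<sink_elim_index D. sink_sequence D i) \<or>
      (\<exists>c. directed_hole D c \<and> length c = 4 \<and>
         cycle_verts D c \<subseteq> set (pre_digraph.awalk_verts D u Z) \<and>
         (\<forall>X\<in>P. X \<inter> cycle_verts D c \<noteq> {} \<longrightarrow> w \<notin> X))"
  shows "\<exists>N::nat. 0 < N \<and>
    (\<forall>m\<ge>N. \<exists>Z'. pre_digraph.awalk D u Z' w \<and> length Z' = l + 2 * m)"
proof -
  interpret multipartite_tournament D P by fact
  have "awalk u Z w" using assms(3) by (simp add: type2_walk_def)
  \<comment> \<open>In case (ii) this is the hole given there, in case (i) the one from Type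
    2.\<close>
  obtain c where hole: "directed_hole D c" "length c = 4"
    and on_Z: "cycle_verts D c \<subseteq> set (awalk_verts u Z)"
    and w: "w \<in> (\<Union>i<sink_elim_index D. sink_sequence D i) \<or>
      (\<forall>X\<in>P. X \<inter> cycle_verts D c \<noteq> {} \<longrightarrow> w \<notin> X)"
    using assms(3,5) unfolding type2_walk_def by blast
  obtain v where v: "hole_cycle D v" "range v = cycle_verts D c"
    using directed_hole_imp_hole_cycle[OF hole] .
  have "v 0 \<in> set (awalk_verts u Z)" using v(2) on_Z by blast
  then obtain q r where Z: "Z = q @ r" "awalk u q (v 0)" "awalk (v 0) r w"
    using awalk_decomp[OF \<open>awalk u Z w\<close>] by blast
  have "\<exists>n. walk_len D n (v 0) w \<and> n mod 4 = (length r + 2) mod 4"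
  proof (rule ccontr)
    assume "\<not> ?thesis"
    \<comment> \<open>The part \<open>X\<close> contains \<open>w\<close> and meets the hole, which
      rules out case (ii); the walk from \<open>w\<close> back to the hole then rules out case
      (i).\<close>
    then obtain k X where k: "walk_len D k w (v 0)" and X: "X \<in> P" "w \<in> X" "v (length r) \<in> X"
      using hole_cycle_walk_cases[OF v(1) Z(3)] by blast
    have "v (length r) \<in> cycle_verts D c" using v(2) by blast
    then obtain i where "w \<in> sink_sequence D i" using w X by blast
    moreover have "v 0 \<rightarrow>\<^sup>+\<^bsub>D\<^esub> v 0"
    proof -
      have "v 0 \<rightarrow>\<^bsub>D\<^esub> v 1" using v(1) by (simp add: hole_cycle_def)
      moreover have "v 1 \<rightarrow>\<^sup>*\<^bsub>D\<^esub> v 0"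
        using hole_cycle_walk_mod[OF v(1), of 1 3] walk_len_reachable by simp
      ultimately show ?thesis by (metis reachable1_reachable_trans r_into_trancl)
    qed
    ultimately show False using sink_sequence_not_reachable walk_len_reachable[OF k] by blast
  qed
  then obtain n where n: "walk_len D n (v 0) w" "n mod 4 = (length r + 2) mod 4" by blast
  have wind: "walk_len D (length q + 4 * k + j) u w" if "walk_len D j (v 0) w" for j k
  proof -
    have "walk_len D (length q) u (v 0)" using Z(2) by (auto simp: walk_len_def)
    moreover have "walk_len D (4 * k) (v 0) (v 0)" by (rule hole_cycle_walk_mod[OF v(1)]) simp
    ultimately show ?thesis using walk_len_trans that by blast
  qed
  \<comment> \<open>For even \<open>m\<close>, keep \<open>r\<close> and wind around the hole
    \<open>m div 2\<close> times. For odd \<open>m\<close>, replace \<open>r\<close> by the walk of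
    length \<open>n\<close>; the bound on \<open>m\<close> leaves a nonnegative multiple of 4 for
    winding, and \<open>Suc n\<close> is positive as a choice of \<open>N\<close>.\<close>
  have len: "walk_len D (l + 2 * m) u w" if "m \<ge> Suc n" for m
  proof -
    have l: "l = length q + length r" using assms(4) Z(1) by simp
    have "walk_len D (length r) (v 0) w" using Z(3) by (auto simp: walk_len_def)
    moreover have "(\<exists>k. l + 2 * m = length q + 4 * k + length r) \<or>
        (\<exists>k. l + 2 * m = length q + 4 * k + n)"
    proof (cases "even m")
      case True
      then show ?thesis unfolding l by (auto elim!: evenE)
    next
      case False
      then obtain j where "m = 2 * j + 1" by (auto elim: oddE)
      then have "length r + 2 * m = (length r + 2) + 4 * j" by simp
      then have "(length r + 2 * m) mod 4 = n mod 4" using n(2) by (metis mod_mult_self2)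
      moreover have "n \<le> length r + 2 * m" using that by simp
      ultimately have "4 dvd length r + 2 * m - n" by (simp add: mod_eq_dvd_iff_nat)
      then obtain k where "length r + 2 * m - n = 4 * k" by (elim dvdE)
      then show ?thesis unfolding l using that by (intro disjI2 exI[of _ k]) linarith
    qed
    ultimately show ?thesis using wind n(1) by metis
  qed
  show ?thesis
  proof (intro exI[of _ "Suc n"] conjI allI impI)
    show "\<exists>Z'. awalk u Z' w \<and> length Z' = l + 2 * m" if "Suc n \<le> m" for m
      using len[OF that] by (simp add: walk_len_def)
  qed simp
qed

end
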